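(* Let $p$ be a selective ultrafilter on $\omega$, let $u\in\mathscr G^p$ be nonprincipal, and let $\langle u_n : n<\omega\rangle$ be any sequence of ultrafilters on $\omega$ with $u=p\text{-}\lim_n u_n$. Then: (1) the sequence $\langle u_n\rangle$ is either $p$-constant or $p$-equal to the $p$-generating sequence of $u$ (p-generating sequences of $u$ exist and any two are $p$-equal); (2) there exists $X\in p$ such that $u_n\in\mathscr G^p$ for $n\in X$ and $\rho_p(u)\ge\sup\{\rho_p(u_n) : n\in X\}$, and moreover, if $\langle u_n\rangle$ is not $p$-constant, then $\rho_p(u)=\sup\{\rho_p(u_n)+1 : n\in X\}$.
   Context: A nonprincipal ultrafilter $p$ on $\omega$ is selective if for every partition $\omega=\bigcup_n X_n$ either some $X_n\in p$ or there is $A\in p$ with $|A\cap X_n|\le1$ for all $n$. $p\text{-}\lim_n u_n=\{A : \{n : A\in u_n\}\in p\}$. $\mathscr G^p_1$ = principal ultrafilters on $\omega$, $\mathscr G^p_{\alpha+1}=\{p\text{-}\lim_n u_n : u_n\in\mathscr G^p_\alpha\}$, unions at limits, $\mathscr G^p=\bigcup_{\alpha\ge1}\mathscr G^p_\alpha$; for $u\in\mathscr G^p$, $\rho_p(u)=\min\{\alpha : u\in\mathscr G^p_{\alpha+1}\}$. A sequence $\langle u_n\rangle$ of elements of $\mathscr G^p$ is a $p$-generating sequence for $u$ if $u=p\text{-}\lim_n u_n$ and $\rho_p(u_n)<\rho_p(u)$ for all $n$. A sequence $\langle u_n\rangle$ is $p$-constant if there is $v$ with $\{n : u_n=v\}\in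 p$; two sequences $\langle u_n\rangle,\langle v_n\rangle$ are $p$-equal if $\{n : u_n=v_n\}\in p$. *)

theory Defs
  imports Complex_Main "HOL-Library.Countable_Set" "HOL-Library.Disjoint_Sets"
begin

section \<open>Ordinals\<close>

text \<open>
  HOL has no type of all ordinals. The type below consists of the ordinals less than the
  successor cardinal of \<open>2^(2^\<omega>)\<close>, the cardinality of the type \<open>nat set set\<close>. There are at
  most \<open>2^(2^\<omega>)\<close> ultrafilters on \<open>\<omega>\<close>, so an increasing hierarchy of sets of ultrafilters
  stops growing below that cardinal; lemma \<open>p_lim_in_pgen\<close> shows that nothing is missing from
  the union over this type.
\<close>

typedef ordinal = "Field (cardSuc (card_of (UNIV :: nat set set)))"
proof -
  have "Field (cardSuc (card_of (UNIV :: nat set set))) \<noteq> {}"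
    by (metis Field_card_of UNIV_not_empty cardSuc_greater card_of_Card_order card_of_empty
        card_of_Field_ordIso cardSuc_Card_order not_ordLess_ordLeq ordIso_ordLeq_trans
        ordIso_symmetric ordLess_ordLeq_trans)
  then show ?thesis
    by blast
qed

lemma Well_order_ordinal: "Well_order (cardSuc (card_of (UNIV :: nat set set)))"
  using cardSuc_Card_order card_of_Card_order card_order_on_well_order_on by blast

instantiation ordinal :: wellorder
begin

definition less_eq_ordinal :: "ordinal \<Rightarrow> ordinal \<Rightarrow> bool" where
  "\<alpha> \<le> \<beta> \<longleftrightarrow> (Rep_ordinal \<alpha>, Rep_ordinal \<beta>) \<in> cardSuc (card_of (UNIV :: nat set set))"

definition less_ordinal :: "ordinal \<Rightarrow> ordinal \<Rightarrow> bool" where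
  "\<alpha> < \<beta> \<longleftrightarrow> \<alpha> \<le> \<beta> \<and> \<not> \<beta> \<le> (\<alpha> :: ordinal)"

instance
proof -
  let ?r = "cardSuc (card_of (UNIV :: nat set set))"
  have r: "refl_on (Field ?r) ?r" "trans ?r" "antisym ?r" "total_on (Field ?r) ?r" "wf (?r - Id)"
    using Well_order_ordinal
    by (auto simp: well_order_on_def linear_order_on_def partial_order_on_def preorder_on_def)
  have wf: "wf {(x, y). x < (y :: ordinal)}"
  proof (rule wf_subset)
    show "wf (inv_image (?r - Id) Rep_ordinal)"
      using r(5) by (rule wf_inv_image)
    show "{(x, y). x < (y :: ordinal)} \<subseteq> inv_image (?r - Id) Rep_ordinal"
      by (auto simp: less_ordinal_def less_eq_ordinal_def inv_image_def)
  qed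
  show "OFCLASS(ordinal, wellorder_class)"
  proof
    fix x y z :: ordinal and P :: "ordinal \<Rightarrow> bool" and a
    show "x < y \<longleftrightarrow> x \<le> y \<and> \<not> y \<le> x"
      by (rule less_ordinal_def)
    show "x \<le> x"
      using r(1) Rep_ordinal unfolding less_eq_ordinal_def by (meson refl_onD)
    show "x \<le> z" if "x \<le> y" "y \<le> z"
      using that r(2) unfolding less_eq_ordinal_def by (meson transD)
    show "x = y" if "x \<le> y" "y \<le> x"
      using that r(3) unfolding less_eq_ordinal_def by (meson antisymD Rep_ordinal_inject)
    show "x \<le> y \<or> y \<le> x"
      using r(1,4) Rep_ordinal[of x] Rep_ordinal[of y] unfolding less_eq_ordinal_def
      by (metis refl_onD total_on_def)
    show "P a" if "\<And>x. (\<And>y. y < x \<Longrightarrow> P y) \<Longrightarrow> P x"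
      using wf that by (induction a rule: wf_induct_rule) auto
  qed
qed

end

instantiation ordinal :: "{zero, conditionally_complete_linorder}"
begin

definition zero_ordinal :: ordinal where "(0 :: ordinal) = (LEAST \<alpha>. True)"
definition inf_ordinal :: "ordinal \<Rightarrow> ordinal \<Rightarrow> ordinal" where "inf_ordinal = min"
definition sup_ordinal :: "ordinal \<Rightarrow> ordinal \<Rightarrow> ordinal" where "sup_ordinal = max"
definition Inf_ordinal :: "ordinal set \<Rightarrow> ordinal" where "Inf A = (LEAST \<alpha> :: ordinal. \<alpha> \<in> A)"
definition Sup_ordinal :: "ordinal set \<Rightarrow> ordinal" where "Sup A = (LEAST \<beta> :: ordinal. \<forall>\<alpha>\<in>A. \<alpha> \<le> \<beta>)"

instance
proof
  fix x y z :: ordinal and X :: "ordinal set"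
  show "inf x y \<le> x" "inf x y \<le> y" "x \<le> sup x y" "y \<le> sup x y"
    by (auto simp: inf_ordinal_def sup_ordinal_def)
  show "x \<le> inf y z" if "x \<le> y" "x \<le> z"
    using that by (auto simp: inf_ordinal_def)
  show "sup y z \<le> x" if "y \<le> x" "z \<le> x"
    using that by (auto simp: sup_ordinal_def)
  show "Inf X \<le> x" if "x \<in> X"
    using that by (auto simp: Inf_ordinal_def intro: Least_le)
  show "z \<le> Inf X" if "X \<noteq> {}" "\<And>x. x \<in> X \<Longrightarrow> z \<le> x"
    using that LeastI_ex[of "\<lambda>\<alpha>. \<alpha> \<in> X"] by (auto simp: Inf_ordinal_def)
  show "x \<le> Sup X" if "x \<in> X" "bdd_above X"
    using that LeastI_ex[of "\<lambda>\<beta>. \<forall>\<alpha>\<in>X. \<alpha> \<le> \<beta>"] by (auto simp: Sup_ordinal_def bdd_above_def)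
  show "Sup X \<le> z" if "\<And>x. x \<in> X \<Longrightarrow> x \<le> z"
    using that by (auto simp: Sup_ordinal_def intro: Least_le)
qed

end

lemma zero_le_ordinal [simp]: "0 \<le> (\<alpha> :: ordinal)"
  by (simp add: zero_ordinal_def Least_le)

definition osuc :: "ordinal \<Rightarrow> ordinal" where
  "osuc \<alpha> = (LEAST \<beta>. \<alpha> < \<beta>)"

definition limit_ordinal :: "ordinal \<Rightarrow> bool" where
  "limit_ordinal \<alpha> \<longleftrightarrow> \<alpha> \<noteq> 0 \<and> (\<forall>\<beta>. \<alpha> \<noteq> osuc \<beta>)"

lemma infinite_UNIV_nat_set_set: "infinite (UNIV :: nat set set)"
  by (simp add: Finite_Set.finite_set)

lemma ex_greater_ordinal: "\<exists>\<beta>. (\<alpha> :: ordinal) < \<beta>"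
proof -
  let ?r = "cardSuc (card_of (UNIV :: nat set set))"
  have "Card_order ?r" "\<not> finite (Field ?r)"
    using infinite_UNIV_nat_set_set cardSuc_finite[OF card_of_Card_order]
      cardSuc_Card_order[OF card_of_Card_order]
    unfolding Field_card_of by blast+
  then obtain b where b: "b \<in> Field ?r" "Rep_ordinal \<alpha> \<noteq> b" "(Rep_ordinal \<alpha>, b) \<in> ?r"
    using infinite_Card_order_limit Rep_ordinal by metis
  then have "\<alpha> \<le> Abs_ordinal b" "\<alpha> \<noteq> Abs_ordinal b"
    by (auto simp: less_eq_ordinal_def Abs_ordinal_inverse)
  then show ?thesis
    by (auto simp: order.order_iff_strict)
qed

lemma less_osuc [simp]: "\<alpha> < osuc \<alpha>"
  unfolding osuc_def by (rule LeastI_ex) (rule ex_greater_ordinal)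

lemma osuc_le_iff: "osuc \<alpha> \<le> \<beta> \<longleftrightarrow> \<alpha> < \<beta>"
  using less_osuc[of \<alpha>] by (auto simp: osuc_def intro: Least_le order.strict_trans2)

lemma less_osuc_iff: "\<alpha> < osuc \<beta> \<longleftrightarrow> \<alpha> \<le> \<beta>"
  using osuc_le_iff[of \<beta> \<alpha>] by (auto simp: not_le[symmetric])

lemma osuc_inject [simp]: "osuc \<alpha> = osuc \<beta> \<longleftrightarrow> \<alpha> = \<beta>"
  by (metis less_osuc_iff order.eq_iff)

lemma osuc_neq_0 [simp]: "osuc \<alpha> \<noteq> 0" "0 \<noteq> osuc \<alpha>"
  using less_osuc[of \<alpha>] by (auto simp: not_le[symmetric])

lemma bdd_above_countable_ordinal:
  fixes A :: "ordinal set"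
  assumes "countable A"
  shows "bdd_above A"
proof -
  let ?c = "card_of (UNIV :: nat set set)"
  let ?r = "cardSuc ?c"
  let ?As = "\<lambda>j. {x \<in> Field ?r. (x, j) \<in> ?r}"
  have trans: "trans ?r" and refl: "refl_on (Field ?r) ?r"
    using Well_order_ordinal
    by (auto simp: well_order_on_def linear_order_on_def partial_order_on_def preorder_on_def)
  have chain: "relChain ?r ?As"
    unfolding relChain_def using trans by (blast dest: transD)
  have sub: "Rep_ordinal ` A \<subseteq> (\<Union>i \<in> Field ?r. ?As i)"
    using refl Rep_ordinal by (fastforce dest: refl_onD)
  have "countable (Rep_ordinal ` A)"
    using assms by simp
  then have "(card_of (Rep_ordinal ` A), card_of (UNIV :: nat set)) \<in> ordLeq"
    by (auto simp: countable_def card_of_ordLeq[symmetric])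
  moreover have "(card_of (UNIV :: nat set), ?c) \<in> ordLeq"
    using infinite_UNIV_nat_set_set infinite_iff_card_of_nat by blast
  ultimately have "(card_of (Rep_ordinal ` A), ?c) \<in> ordLeq"
    using ordLeq_transitive by blast
  then obtain i where i: "i \<in> Field ?r" "Rep_ordinal ` A \<subseteq> ?As i"
    using cardSuc_UNION[OF card_of_Card_order _ chain sub] infinite_UNIV_nat_set_set
    unfolding Field_card_of by blast
  then show ?thesis
    by (intro bdd_aboveI[of _ "Abs_ordinal i"]) (auto simp: less_eq_ordinal_def Abs_ordinal_inverse)
qed


section \<open>Ultrafilters and limits along an ultrafilter\<close>

text \<open>
  An ultrafilter is represented as a \<open>nat filter\<close>; \<open>A\<close> belongs to \<open>u\<close> iff
  \<open>\<forall>\<^sub>F n in u. n \<in> A\<close>. The type of filters includes the improper filter \<open>bot\<close>.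
\<close>

definition ultrafilter :: "'a filter \<Rightarrow> bool" where
  "ultrafilter u \<longleftrightarrow> u \<noteq> bot \<and> (\<forall>A. (\<forall>\<^sub>F x in u. x \<in> A) \<or> (\<forall>\<^sub>F x in u. x \<notin> A))"

definition principal_ultrafilters :: "'a filter set" where
  "principal_ultrafilters = range (\<lambda>x. principal {x})"

text \<open>Parts of a partition are allowed to be empty; this covers partitions into finitely many parts.\<close>

definition selective :: "nat filter \<Rightarrow> bool" where
  "selective p \<longleftrightarrow> ultrafilter p \<and> p \<notin> principal_ultrafilters \<and>
     (\<forall>X :: nat \<Rightarrow> nat set. disjoint_family X \<and> (\<Union>n. X n) = UNIV \<longrightarrow>
        (\<exists>n. \<forall>\<^sub>F k in p. k \<in> X n) \<or>
        (\<exists>A. (\<forall>\<^sub>F k in p. k \<in> A) \<and> (\<forall>n. finite (A \<inter> X n) \<and> card (A \<inter> X n) \<le> 1)))"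

definition p_lim :: "nat filter \<Rightarrow> (nat \<Rightarrow> 'a filter) \<Rightarrow> 'a filter" where
  "p_lim p u = Abs_filter (\<lambda>P. \<forall>\<^sub>F n in p. \<forall>\<^sub>F x in u n. P x)"

lemma eventually_p_lim: "eventually P (p_lim p u) \<longleftrightarrow> (\<forall>\<^sub>F n in p. eventually P (u n))"
  unfolding p_lim_def
proof (rule eventually_Abs_filter, rule is_filter.intro)
  show "\<forall>\<^sub>F n in p. eventually (\<lambda>x. P x \<and> Q x) (u n)"
    if "\<forall>\<^sub>F n in p. eventually P (u n)" "\<forall>\<^sub>F n in p. eventually Q (u n)" for P Q
    using that by eventually_elim (rule eventually_conj)
  show "\<forall>\<^sub>F n in p. eventually Q (u n)"
    if "\<forall>x. P x \<longrightarrow> Q x" "\<forall>\<^sub>F n in p. eventually P (u n)" for P Q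
    using that(2) by eventually_elim (use that(1) in \<open>auto elim: eventually_mono\<close>)
qed simp

lemma mem_p_lim: "(\<forall>\<^sub>F x in p_lim p u. x \<in> A) \<longleftrightarrow> (\<forall>\<^sub>F n in p. n \<in> {n. \<forall>\<^sub>F x in u n. x \<in> A})"
  by (simp add: eventually_p_lim)


section \<open>The hierarchy of ultrafilters generated by \<open>p\<close>\<close>

text \<open>
  The hierarchy starts at index 1; the level with index 0 is set to be empty. The three defining
  clauses are \<open>pgen_level_1\<close>, \<open>pgen_level_osuc\<close> and \<open>pgen_level_limit\<close> below.
\<close>

function pgen_level :: "nat filter \<Rightarrow> ordinal \<Rightarrow> nat filter set" where
  "pgen_level p \<alpha> =
     (if \<alpha> = 0 then {}
      else if \<alpha> = osuc 0 then principal_ultrafilters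
      else if limit_ordinal \<alpha> then (\<Union>\<beta>\<in>{\<beta>. 0 < \<beta> \<and> \<beta> < \<alpha>}. pgen_level p \<beta>)
      else (\<Union>\<beta>\<in>{\<beta>. \<alpha> = osuc \<beta>}. {p_lim p u | u. \<forall>n. u n \<in> pgen_level p \<beta>}))"
  by pat_completeness auto
termination
  by (relation "inv_image {(x, y). x < y} snd") (auto simp: wf)

declare pgen_level.simps [simp del]

lemma pgen_level_0: "pgen_level p 0 = {}"
  by (simp add: pgen_level.simps)

lemma pgen_level_1: "pgen_level p (osuc 0) = principal_ultrafilters"
  by (simp add: pgen_level.simps)

lemma pgen_level_osuc:
  assumes "osuc 0 \<le> \<alpha>"
  shows "pgen_level p (osuc \<alpha>) = {p_lim p u | u. \<forall>n. u n \<in> pgen_level p \<alpha>}"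
  using assms
  by (subst pgen_level.simps) (auto simp: limit_ordinal_def osuc_le_iff)

lemma pgen_level_limit:
  assumes "limit_ordinal \<alpha>"
  shows "pgen_level p \<alpha> = (\<Union>\<beta>\<in>{osuc 0..<\<alpha>}. pgen_level p \<beta>)"
  using assms
  by (subst pgen_level.simps) (auto simp: limit_ordinal_def osuc_le_iff)

definition pgen :: "nat filter \<Rightarrow> nat filter set" where
  "pgen p = (\<Union>\<alpha>\<in>{osuc 0..}. pgen_level p \<alpha>)"

definition pgen_rank :: "nat filter \<Rightarrow> nat filter \<Rightarrow> ordinal" where
  "pgen_rank p u = (LEAST \<alpha>. u \<in> pgen_level p (osuc \<alpha>))"

definition p_generating :: "nat filter \<Rightarrow> (nat \<Rightarrow> nat filter) \<Rightarrow> nat filter \<Rightarrow> bool" where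
  "p_generating p us u \<longleftrightarrow>
     (\<forall>n. us n \<in> pgen p) \<and> u = p_lim p us \<and> (\<forall>n. pgen_rank p (us n) < pgen_rank p u)"

definition p_constant :: "nat filter \<Rightarrow> (nat \<Rightarrow> 'a) \<Rightarrow> bool" where
  "p_constant p us \<longleftrightarrow> (\<exists>v. \<forall>\<^sub>F n in p. us n = v)"

definition p_equal :: "nat filter \<Rightarrow> (nat \<Rightarrow> 'a) \<Rightarrow> (nat \<Rightarrow> 'a) \<Rightarrow> bool" where
  "p_equal p us vs \<longleftrightarrow> (\<forall>\<^sub>F n in p. us n = vs n)"


section \<open>The hierarchy does not depend on the bound on the ordinals\<close>

lemma p_lim_const:
  assumes "p \<noteq> bot"
  shows "p_lim p (\<lambda>_. u) = u"
  using assms by (auto simp: filter_eq_iff eventually_p_lim)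

lemma pgen_level_mono:
  assumes "p \<noteq> bot" "\<alpha> \<le> \<beta>"
  shows "pgen_level p \<alpha> \<subseteq> pgen_level p \<beta>"
  using assms(2)
proof (induction \<beta> rule: less_induct)
  case (less \<beta>)
  show ?case
  proof (cases "\<alpha> = \<beta> \<or> \<alpha> = 0")
    case True
    then show ?thesis by (auto simp: pgen_level_0)
  next
    case False
    then have lt: "\<alpha> < \<beta>" "osuc 0 \<le> \<alpha>"
      using less.prems by (auto simp: osuc_le_iff less_le)
    show ?thesis
    proof (cases "limit_ordinal \<beta>")
      case True
      then show ?thesis using lt by (auto simp: pgen_level_limit)
    next
      case False
      then obtain \<gamma> where \<gamma>: "\<beta> = osuc \<gamma>"
        using lt zero_le_ordinal[of \<alpha>] unfolding limit_ordinal_def by (metis not_le)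
      then have "\<alpha> \<le> \<gamma>"
        using lt by (simp add: less_osuc_iff)
      then have "pgen_level p \<alpha> \<subseteq> pgen_level p \<gamma>"
        using less.IH \<gamma> by simp
      moreover have "pgen_level p \<gamma> \<subseteq> pgen_level p (osuc \<gamma>)"
      proof
        fix x assume "x \<in> pgen_level p \<gamma>"
        then have "\<exists>u. x = p_lim p u \<and> (\<forall>n. u n \<in> pgen_level p \<gamma>)"
          by (intro exI[of _ "\<lambda>_. x"]) (simp add: p_lim_const[OF assms(1)])
        then show "x \<in> pgen_level p (osuc \<gamma>)"
          using lt \<open>\<alpha> \<le> \<gamma>\<close> by (simp add: pgen_level_osuc)
      qed
      ultimately show ?thesis
        using \<gamma> by blast
    qed
  qed
qed

lemma p_lim_in_pgen:
  assumes "p \<noteq> bot" "\<And>n. u n \<in> pgen p"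
  shows "p_lim p u \<in> pgen p"
proof -
  have "\<forall>n. \<exists>\<alpha>. osuc 0 \<le> \<alpha> \<and> u n \<in> pgen_level p \<alpha>"
    using assms(2) by (auto simp: pgen_def)
  then obtain f where f: "\<And>n. osuc 0 \<le> f n" "\<And>n. u n \<in> pgen_level p (f n)"
    by metis
  have "bdd_above (range f)"
    by (rule bdd_above_countable_ordinal) simp
  then obtain \<beta> where \<beta>: "\<And>n. f n \<le> \<beta>"
    by (auto simp: bdd_above_def)
  then have "\<And>n. u n \<in> pgen_level p \<beta>"
    using pgen_level_mono[OF assms(1)] f(2) by blast
  moreover have "osuc 0 \<le> \<beta>"
    using f(1) \<beta> order_trans by blast
  ultimately have "p_lim p u \<in> pgen_level p (osuc \<beta>)"
    by (auto simp: pgen_level_osuc)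
  then show ?thesis
    unfolding pgen_def using order_trans[OF \<open>osuc 0 \<le> \<beta>\<close> less_imp_le[OF less_osuc]] by auto
qed

end

theory Submission
  imports Defs
begin

text \<open>
  Suppose \<open>u\<close> is the \<open>p\<close>-limit of two sequences that are not \<open>p\<close>-constant and differ \<open>p\<close>-almost
  everywhere. Choose disjoint \<open>A n \<in> us n\<close> and \<open>B n \<in> vs n\<close>, neither of them in \<open>u\<close>. Then
  \<open>A n \<union> B n\<close> lies in neither \<open>us m\<close> nor \<open>vs m\<close> for \<open>p\<close>-almost all \<open>m\<close>, and since a selective
  ultrafilter is closed under diagonal intersections there is \<open>Y \<in> p\<close> such that this holds for all
  \<open>n < m\<close> in \<open>Y\<close>. Removing \<open>A k \<union> B k\<close> for \<open>k < n\<close> in \<open>Y\<close> from \<open>A n\<close> and \<open>B n\<close> makes the two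
  unions over \<open>n \<in> Y\<close> disjoint, although both belong to \<open>u\<close>. Hence a sequence that is not
  \<open>p\<close>-constant is determined by its \<open>p\<close>-limit up to \<open>p\<close>-equality, and the statements about ranks
  reduce to the case of \<open>p\<close>-generating sequences.
\<close>

section \<open>Ultrafilters and their limits along \<open>p\<close>\<close>

lemma eventually_not_ultrafilter:
  assumes "ultrafilter u"
  shows "eventually (\<lambda>x. \<not> P x) u \<longleftrightarrow> \<not> eventually P u"
proof -
  have "eventually P u \<or> eventually (\<lambda>x. \<not> P x) u"
    using assms unfolding ultrafilter_def by (auto dest: spec[of _ "{x. P x}"])
  moreover have False if "eventually P u" "eventually (\<lambda>x. \<not> P x) u"
    using eventually_conj[OF that] assms by (simp add: ultrafilter_def)
  ultimately show ?thesis by blast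
qed

lemma ultrafilter_principal: "ultrafilter (principal {x})"
  by (simp add: ultrafilter_def eventually_principal principal_eq_bot_iff)

lemma ultrafilter_p_lim:
  assumes "ultrafilter p" "\<And>n. ultrafilter (us n)"
  shows "ultrafilter (p_lim p us)"
proof -
  have "eventually P (p_lim p us) \<or> eventually (\<lambda>x. \<not> P x) (p_lim p us)" for P
    by (auto simp: eventually_p_lim eventually_not_ultrafilter assms)
  moreover have "p_lim p us \<noteq> bot"
    using assms by (auto simp: ultrafilter_def trivial_limit_def eventually_p_lim)
  ultimately show ?thesis
    by (auto simp: ultrafilter_def)
qed

lemma ultrafilter_neq_separate:
  assumes "ultrafilter u" "ultrafilter v" "u \<noteq> v"
  obtains A where "\<forall>\<^sub>F x in u. x \<in> A" "\<forall>\<^sub>F x in v. x \<notin> A"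
proof -
  obtain P where "eventually P u \<noteq> eventually P v"
    using assms(3) by (auto simp: filter_eq_iff)
  then show ?thesis
    using that[of "{x. P x}"] that[of "{x. \<not> P x}"] eventually_not_ultrafilter[OF assms(1), of P]
      eventually_not_ultrafilter[OF assms(2), of P]
    by auto
qed

text \<open>Otherwise \<open>{a}\<close> would belong to \<open>p\<close> and every set in
  \<open>p\<close> would meet it, so \<open>p\<close> would be \<open>principal {a}\<close>.\<close>

lemma nonprincipal_ultrafilter_eventually_neq:
  assumes "ultrafilter p" "p \<notin> principal_ultrafilters"
  shows "\<forall>\<^sub>F x in p. x \<noteq> a"
proof (rule ccontr)
  assume "\<not> ?thesis"
  then have "\<forall>\<^sub>F x in p. x = a"
    using eventually_not_ultrafilter[OF assms(1), of "\<lambda>x. x = a"] by simp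
  then have "p \<le> principal {a}"
    by (simp add: le_principal)
  moreover have "principal {a} \<le> p"
    unfolding le_filter_def eventually_principal
  proof (intro allI impI)
    fix P assume "eventually P p"
    then have "\<forall>\<^sub>F x in p. P x \<and> x = a"
      using \<open>\<forall>\<^sub>F x in p. x = a\<close> by (rule eventually_conj)
    then have "\<exists>x. P x \<and> x = a"
      using assms(1) by (intro eventually_happens') (auto simp: ultrafilter_def)
    then show "\<forall>x\<in>{a}. P x" by auto
  qed
  ultimately show False
    using assms(2) by (auto simp: principal_ultrafilters_def)
qed

lemma nonprincipal_ultrafilter_finite:
  assumes "ultrafilter p" "p \<notin> principal_ultrafilters" "finite A"
  shows "\<forall>\<^sub>F x in p. x \<notin> A"
proof -
  have "\<forall>\<^sub>F x in p. \<forall>a\<in>A. x \<noteq> a"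
    using assms by (simp add: eventually_ball_finite_distrib nonprincipal_ultrafilter_eventually_neq)
  then show ?thesis
    by eventually_elim auto
qed

section \<open>Injectivity and diagonal intersections for selective ultrafilters\<close>

text \<open>The fibres of \<open>f\<close> partition the natural numbers and none of them belongs to
  \<open>p\<close>, so selectivity yields a set in \<open>p\<close> meeting each fibre at most
  once.\<close>

lemma selective_inj_on:
  fixes f :: "nat \<Rightarrow> nat"
  assumes p: "selective p" and f: "\<And>n. \<forall>\<^sub>F k in p. f k \<noteq> n"
  obtains A where "\<forall>\<^sub>F k in p. k \<in> A" "inj_on f A"
proof -
  let ?X = "\<lambda>n. f -` {n}"
  have u: "ultrafilter p" using p by (simp add: selective_def)
  have "disjoint_family ?X" "(\<Union>n. ?X n) = UNIV"
    by (auto simp: disjoint_family_on_def)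
  then have "(\<exists>n. \<forall>\<^sub>F k in p. k \<in> ?X n) \<or>
    (\<exists>A. (\<forall>\<^sub>F k in p. k \<in> A) \<and> (\<forall>n. finite (A \<inter> ?X n) \<and> card (A \<inter> ?X n) \<le> 1))"
    using p unfolding selective_def by blast
  moreover have "\<not> (\<forall>\<^sub>F k in p. k \<in> ?X n)" for n
    using f[of n] eventually_not_ultrafilter[OF u, of "\<lambda>k. f k = n"] by simp
  ultimately obtain A where A: "\<forall>\<^sub>F k in p. k \<in> A"
    "\<And>n. finite (A \<inter> ?X n)" "\<And>n. card (A \<inter> ?X n) \<le> 1"
    by blast
  have "x = y" if "x \<in> A" "y \<in> A" "f x = f y" for x y
  proof -
    have "{x, y} \<subseteq> A \<inter> ?X (f x)" using that by auto
    then have "card {x, y} \<le> 1" using A(2,3) card_mono order_trans by metis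
    then show ?thesis by (cases "x = y") auto
  qed
  then have "inj_on f A" by (rule inj_onI)
  with A(1) show ?thesis by (rule that)
qed

text \<open>Selectivity is used twice: first to bound how large \<open>m\<close> can be while
  \<open>h m\<close> stays small, then to keep at most one point in each block of a fast growing
  sequence. Keeping only blocks of one parity separates the points far enough to give
  \<open>n < h m\<close>.\<close>

lemma selective_diagonal:
  assumes p: "selective p" and B: "\<And>n. \<forall>\<^sub>F m in p. m \<in> B n"
  obtains Y where "\<forall>\<^sub>F n in p. n \<in> Y" "\<And>n m. n \<in> Y \<Longrightarrow> m \<in> Y \<Longrightarrow> n < m \<Longrightarrow> m \<in> B n"
proof -
  have u: "ultrafilter p" and np: "p \<notin> principal_ultrafilters"
    using p by (auto simp: selective_def)
  \<comment> \<open>\<open>h m\<close> measures how many initial sets \<open>B k\<close> contain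
    \<open>m\<close>; the disjunct \<open>m \<le> n\<close> caps it at \<open>m\<close>, so the
    least element exists.\<close>
  define h where "h m = (LEAST n. m \<le> n \<or> m \<notin> B n)" for m
  have h_B: "m \<in> B k" if "k < h m" for m k
    using not_less_Least that unfolding h_def by blast
  \<comment> \<open>The value \<open>n\<close> can be taken only at points up to \<open>n\<close> or
    outside \<open>B n\<close>, and these form a set not in \<open>p\<close>.\<close>
  have "\<forall>\<^sub>F m in p. h m \<noteq> n" for n
  proof -
    have "\<forall>\<^sub>F m in p. m \<in> B n \<and> m \<notin> {..n}"
      using B nonprincipal_ultrafilter_finite[OF u np finite_atMost] by (rule eventually_conj)
    then show ?thesis
    proof eventually_elim
      case (elim m)
      have "m \<le> h m \<or> m \<notin> B (h m)"
        unfolding h_def by (rule LeastI[of _ m]) simp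
      then show ?case using elim by auto
    qed
  qed
  then obtain A where A: "\<forall>\<^sub>F m in p. m \<in> A" "inj_on h A"
    by (rule selective_inj_on[OF p])
  have fin: "finite {m \<in> A. h m \<le> n}" for n
    by (rule inj_on_finite[where f = h and B = "{..n}"])
      (use A(2) in \<open>auto simp: inj_on_def\<close>)
  \<comment> \<open>Endpoints growing so fast that \<open>h m > a k\<close> for all \<open>m \<in> A\<close> beyond \<open>a (Suc k)\<close>.\<close>
  define a where "a = rec_nat 0 (\<lambda>_ x. Suc (x + Max (insert 0 {m \<in> A. h m \<le> x})))"
  have a_Suc: "a (Suc k) = Suc (a k + Max (insert 0 {m \<in> A. h m \<le> a k}))" for k
    by (simp add: a_def)
  have a_gt: "a k < a (Suc k)" for k by (simp add: a_Suc)
  have a_h: "m < a (Suc k)" if "m \<in> A" "h m \<le> a k" for m k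
  proof -
    have "m \<le> Max (insert 0 {m \<in> A. h m \<le> a k})"
      using that fin by (intro Max_ge) auto
    then show ?thesis by (simp add: a_Suc)
  qed
  have sm: "strict_mono a" using a_gt by (simp add: strict_mono_Suc_iff)
  \<comment> \<open>\<open>i x\<close> is the index of the block from \<open>a (i x)\<close> up to
    but excluding \<open>a (Suc (i x))\<close> that contains \<open>x\<close>.\<close>
  define i where "i x = (LEAST k. x < a (Suc k))" for x
  have i_upper: "x < a (Suc (i x))" for x
  proof -
    have "x < a (Suc x)" using strict_mono_imp_increasing[OF sm, of "Suc x"] by simp
    then show ?thesis unfolding i_def by (rule LeastI)
  qed
  have i_lower: "a (Suc k) \<le> x" if "k < i x" for x k
    using not_less_Least that unfolding i_def by (metis not_le)
  have "\<forall>\<^sub>F x in p. i x \<noteq> n" for n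
  proof -
    have "\<forall>\<^sub>F x in p. x \<notin> {..<a (Suc n)}"
      by (rule nonprincipal_ultrafilter_finite[OF u np]) simp
    then show ?thesis
      by eventually_elim (use i_upper in auto)
  qed
  then obtain C where C: "\<forall>\<^sub>F m in p. m \<in> C" "inj_on i C"
    by (rule selective_inj_on[OF p])
  \<comment> \<open>An ultrafilter decides the parity of \<open>i\<close>, so one parity class can
    be kept; this rules out consecutive blocks.\<close>
  have "\<exists>b. \<forall>\<^sub>F x in p. even (i x) = b"
  proof (cases "\<forall>\<^sub>F x in p. even (i x)")
    case True
    then show ?thesis by (intro exI[of _ True]) simp
  next
    case False
    then show ?thesis
      using eventually_not_ultrafilter[OF u, of "\<lambda>x. even (i x)"] by (intro exI[of _ False]) simp
  qed
  then obtain b where b: "\<forall>\<^sub>F x in p. even (i x) = b" ..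
  define Y where "Y = {x \<in> A \<inter> C. even (i x) = b}"
  have "\<forall>\<^sub>F x in p. x \<in> Y"
    using A(1) C(1) b by eventually_elim (simp add: Y_def)
  moreover have "m \<in> B n" if "n \<in> Y" "m \<in> Y" "n < m" for n m
  proof (rule h_B, rule ccontr)
    \<comment> \<open>If \<open>h m \<le> n\<close>, then \<open>m\<close> lies before the end of
      the block following that of \<open>n\<close>, whereas distinct blocks of equal parity put
      \<open>m\<close> at or beyond that end.\<close>
    assume "\<not> n < h m"
    then have "h m \<le> a (Suc (i n))" using i_upper[of n] by simp
    then have m: "m < a (Suc (Suc (i n)))" using a_h that by (auto simp: Y_def)
    have "i n \<noteq> i m" using that C(2) by (auto simp: Y_def inj_on_def)
    moreover have "\<not> i m < i n"
      using i_lower[of "i m" n] i_upper[of m] that by auto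
    ultimately have "i n < i m" by simp
    moreover have "i m \<noteq> Suc (i n)" using that by (auto simp: Y_def)
    ultimately have "Suc (i n) < i m" by simp
    then show False using i_lower m by (metis not_le)
  qed
  ultimately show ?thesis by (rule that)
qed

section \<open>Sequences with a common limit along \<open>p\<close>\<close>

lemma p_lim_p_equal:
  fixes us vs :: "nat \<Rightarrow> 'a filter"
  assumes p: "p \<noteq> bot" and "p_equal p us vs"
  shows "p_lim p us = p_lim p vs"
proof -
  have *: "\<forall>\<^sub>F n in p. eventually P (us n) = eventually P (vs n)" for P
    using assms(2) unfolding p_equal_def by eventually_elim simp
  show ?thesis
    unfolding filter_eq_iff eventually_p_lim using eventually_subst[OF *] by blast
qed

lemma p_lim_eventually_const:
  assumes "p \<noteq> bot" "\<forall>\<^sub>F n in p. us n = v"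
  shows "p_lim p us = v"
  using p_lim_p_equal[OF assms(1), of us "\<lambda>_. v"] assms by (simp add: p_equal_def p_lim_const)

lemma not_p_constant_eventually_neq:
  assumes "ultrafilter p" "\<not> p_constant p us"
  shows "\<forall>\<^sub>F n in p. us n \<noteq> v"
  using assms eventually_not_ultrafilter[OF assms(1), of "\<lambda>n. us n = v"]
  by (auto simp: p_constant_def)

lemma p_lim_eq_imp_p_equal:
  fixes us vs :: "nat \<Rightarrow> 'a filter"
  assumes p: "selective p"
    and us: "\<And>n. ultrafilter (us n)" and vs: "\<And>n. ultrafilter (vs n)"
    and eq: "p_lim p us = p_lim p vs"
    and nc: "\<not> p_constant p us" "\<not> p_constant p vs"
  shows "p_equal p us vs"
proof (rule ccontr)
  assume "\<not> p_equal p us vs"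
  have up: "ultrafilter p" using p by (simp add: selective_def)
  define u where "u = p_lim p us"
  have u: "ultrafilter u" unfolding u_def by (rule ultrafilter_p_lim[OF up us])
  have "\<forall>\<^sub>F n in p. us n \<noteq> vs n"
    using \<open>\<not> p_equal p us vs\<close> eventually_not_ultrafilter[OF up, of "\<lambda>n. us n = vs n"]
    by (simp add: p_equal_def)
  then have neq: "\<forall>\<^sub>F n in p. us n \<noteq> vs n \<and> us n \<noteq> u \<and> vs n \<noteq> u"
    using not_p_constant_eventually_neq[OF up nc(1), of u]
      not_p_constant_eventually_neq[OF up nc(2), of u]
    by eventually_elim simp
  \<comment> \<open>Pairing the two sets lets both be chosen at once. Lying outside \<open>u\<close>
    is what excludes them from \<open>us m\<close> and \<open>vs m\<close> for almost all
    \<open>m\<close>.\<close>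
  define sep where "sep n AB \<longleftrightarrow> (\<forall>\<^sub>F x in us n. x \<in> fst AB) \<and> (\<forall>\<^sub>F x in vs n. x \<in> snd AB) \<and>
    (\<forall>\<^sub>F x in u. x \<notin> fst AB \<union> snd AB) \<and> fst AB \<inter> snd AB = {}" for n AB
  have "\<exists>AB. sep n AB" if n: "us n \<noteq> vs n \<and> us n \<noteq> u \<and> vs n \<noteq> u" for n
  proof -
    obtain A where A: "\<forall>\<^sub>F x in us n. x \<in> A" "\<forall>\<^sub>F x in u. x \<notin> A"
      using ultrafilter_neq_separate[OF us u] n by blast
    obtain B where B: "\<forall>\<^sub>F x in vs n. x \<in> B" "\<forall>\<^sub>F x in u. x \<notin> B"
      using ultrafilter_neq_separate[OF vs u] n by blast
    \<comment> \<open>Cutting by \<open>C\<close> makes the two sets disjoint, and shrinking them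
      keeps them outside \<open>u\<close>.\<close>
    obtain C where C: "\<forall>\<^sub>F x in us n. x \<in> C" "\<forall>\<^sub>F x in vs n. x \<notin> C"
      using ultrafilter_neq_separate[OF us vs] n by blast
    have "\<forall>\<^sub>F x in us n. x \<in> A \<inter> C"
      using A(1) C(1) by eventually_elim simp
    moreover have "\<forall>\<^sub>F x in vs n. x \<in> B - C"
      using B(1) C(2) by eventually_elim simp
    moreover have "\<forall>\<^sub>F x in u. x \<notin> (A \<inter> C) \<union> (B - C)"
      using A(2) B(2) by eventually_elim simp
    ultimately have "sep n (A \<inter> C, B - C)"
      unfolding sep_def by auto
    then show ?thesis ..
  qed
  then obtain AB where AB: "\<And>n. us n \<noteq> vs n \<and> us n \<noteq> u \<and> vs n \<noteq> u \<Longrightarrow> sep n (AB n)"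
    by metis
  define E where "E n = fst (AB n) \<union> snd (AB n)" for n
  \<comment> \<open>The guard makes \<open>D n\<close> the whole set, hence a member of
    \<open>p\<close>, at indices where \<open>AB n\<close> is an arbitrary value.\<close>
  define D where "D n = {m. sep n (AB n) \<longrightarrow> (\<forall>\<^sub>F x in us m. x \<notin> E n) \<and> (\<forall>\<^sub>F x in vs m. x \<notin> E n)}" for n
  have "\<forall>\<^sub>F m in p. m \<in> D n" for n
  proof (cases "sep n (AB n)")
    case True
    then have "\<forall>\<^sub>F x in u. x \<notin> E n" by (simp add: sep_def E_def)
    then have "\<forall>\<^sub>F m in p. \<forall>\<^sub>F x in us m. x \<notin> E n" "\<forall>\<^sub>F m in p. \<forall>\<^sub>F x in vs m. x \<notin> E n"
      unfolding u_def by (simp add: eventually_p_lim, simp add: eq eventually_p_lim)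
    then show ?thesis by eventually_elim (simp add: D_def)
  qed (simp add: D_def)
  then obtain Y0 where Y0: "\<forall>\<^sub>F n in p. n \<in> Y0"
    "\<And>n m. n \<in> Y0 \<Longrightarrow> m \<in> Y0 \<Longrightarrow> n < m \<Longrightarrow> m \<in> D n"
    using selective_diagonal[OF p, of D] by metis
  define Y where "Y = {n \<in> Y0. sep n (AB n)}"
  have Y: "\<forall>\<^sub>F n in p. n \<in> Y"
    using Y0(1) neq by eventually_elim (use AB in \<open>auto simp: Y_def\<close>)
  define S where "S = (\<Union>n\<in>Y. fst (AB n) - (\<Union>k\<in>{k \<in> Y. k < n}. E k))"
  define T where "T = (\<Union>n\<in>Y. snd (AB n) - (\<Union>k\<in>{k \<in> Y. k < n}. E k))"
  \<comment> \<open>Only finitely many sets \<open>E k\<close> are removed at stage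
    \<open>n\<close>, so the trimmed sets still belong to \<open>us n\<close> and
    \<open>vs n\<close>.\<close>
  have less: "(\<forall>\<^sub>F x in us n. \<forall>k\<in>{k \<in> Y. k < n}. x \<notin> E k) \<and>
    (\<forall>\<^sub>F x in vs n. \<forall>k\<in>{k \<in> Y. k < n}. x \<notin> E k)" if "n \<in> Y" for n
  proof -
    have "(\<forall>\<^sub>F x in us n. x \<notin> E k) \<and> (\<forall>\<^sub>F x in vs n. x \<notin> E k)" if "k \<in> Y" "k < n" for k
      using that \<open>n \<in> Y\<close> Y0(2)[of k n] by (simp add: Y_def D_def)
    then show ?thesis
      by (intro conjI eventually_ball_finite) auto
  qed
  have "\<forall>\<^sub>F x in us n. x \<in> S" if "n \<in> Y" for n
  proof -
    have "\<forall>\<^sub>F x in us n. x \<in> fst (AB n)" using that by (simp add: Y_def sep_def)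
    moreover have "\<forall>\<^sub>F x in us n. \<forall>k\<in>{k \<in> Y. k < n}. x \<notin> E k"
      using less that by blast
    ultimately show ?thesis
      by eventually_elim (use that in \<open>auto simp: S_def\<close>)
  qed
  then have "\<forall>\<^sub>F n in p. \<forall>\<^sub>F x in us n. x \<in> S"
    using Y by (auto elim: eventually_mono)
  then have Su: "\<forall>\<^sub>F x in u. x \<in> S"
    by (simp add: u_def eventually_p_lim)
  have "\<forall>\<^sub>F x in vs n. x \<in> T" if "n \<in> Y" for n
  proof -
    have "\<forall>\<^sub>F x in vs n. x \<in> snd (AB n)" using that by (simp add: Y_def sep_def)
    moreover have "\<forall>\<^sub>F x in vs n. \<forall>k\<in>{k \<in> Y. k < n}. x \<notin> E k"
      using less that by blast
    ultimately show ?thesis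
      by eventually_elim (use that in \<open>auto simp: T_def\<close>)
  qed
  then have "\<forall>\<^sub>F n in p. \<forall>\<^sub>F x in vs n. x \<in> T"
    using Y by (auto elim: eventually_mono)
  then have Tu: "\<forall>\<^sub>F x in u. x \<in> T"
    by (simp add: u_def eq eventually_p_lim)
  have "x \<notin> T" if "x \<in> S" for x
  proof
    assume "x \<in> T"
    obtain n where n: "n \<in> Y" "x \<in> fst (AB n)" "\<And>k. k \<in> Y \<Longrightarrow> k < n \<Longrightarrow> x \<notin> E k"
      using \<open>x \<in> S\<close> by (auto simp: S_def)
    obtain m where m: "m \<in> Y" "x \<in> snd (AB m)" "\<And>k. k \<in> Y \<Longrightarrow> k < m \<Longrightarrow> x \<notin> E k"
      using \<open>x \<in> T\<close> by (auto simp: T_def)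
    have "x \<in> E n" "x \<in> E m" using n(2) m(2) by (auto simp: E_def)
    \<comment> \<open>The smaller of two different indices would have had its \<open>E\<close>
      removed at the larger one. At equal indices the two components of \<open>AB n\<close> are
      disjoint.\<close>
    then have "n = m" using n m by (metis nat_neq_iff)
    then show False using n m by (auto simp: Y_def sep_def)
  qed
  with Su have "\<forall>\<^sub>F x in u. x \<notin> T"
    by (auto elim: eventually_mono)
  then show False
    using Tu eventually_not_ultrafilter[OF u, of "\<lambda>x. x \<in> T"] by simp
qed

section \<open>Levels and ranks in the hierarchy generated by \<open>p\<close>\<close>

lemma ultrafilter_pgen_level:
  assumes "ultrafilter p" "u \<in> pgen_level p \<alpha>"
  shows "ultrafilter u"
  using assms(2)
proof (induction \<alpha> arbitrary: u rule: less_induct)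
  case (less \<alpha>)
  consider "\<alpha> = 0" | "\<alpha> = osuc 0" | "limit_ordinal \<alpha>" | \<beta> where "\<alpha> = osuc \<beta>" "osuc 0 \<le> \<beta>"
    unfolding limit_ordinal_def osuc_le_iff
    by (metis zero_le_ordinal order.not_eq_order_implies_strict)
  then show ?case
  proof cases
    case 1
    then show ?thesis using less.prems by (simp add: pgen_level_0)
  next
    case 2
    then show ?thesis
      using less.prems by (auto simp: pgen_level_1 principal_ultrafilters_def ultrafilter_principal)
  next
    case 3
    then show ?thesis using less.prems less.IH by (auto simp: pgen_level_limit)
  next
    case 4
    then obtain us where us: "u = p_lim p us" "\<And>n. us n \<in> pgen_level p \<beta>"
      using less.prems by (auto simp: pgen_level_osuc)
    have "\<And>n. ultrafilter (us n)"
      using us(2) less.IH 4 less_osuc by blast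
    then show ?thesis using us(1) ultrafilter_p_lim assms(1) by blast
  qed
qed

lemma ultrafilter_pgen:
  assumes "ultrafilter p" "u \<in> pgen p"
  shows "ultrafilter u"
  using assms(2) ultrafilter_pgen_level[OF assms(1)] unfolding pgen_def by blast

text \<open>Since the levels increase, a member of any level lies in some successor level, so the
  minimum defining the rank is attained.\<close>

lemma pgen_level_osuc_pgen_rank:
  assumes "p \<noteq> bot" "u \<in> pgen p"
  shows "u \<in> pgen_level p (osuc (pgen_rank p u))"
proof -
  obtain \<alpha> where "u \<in> pgen_level p \<alpha>"
    using assms(2) by (auto simp: pgen_def)
  then have "u \<in> pgen_level p (osuc \<alpha>)"
    using pgen_level_mono[OF assms(1), of \<alpha> "osuc \<alpha>"] less_imp_le[OF less_osuc] by blast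
  then show ?thesis
    unfolding pgen_rank_def by (rule LeastI)
qed

lemma pgen_rank_le: "u \<in> pgen_level p (osuc \<alpha>) \<Longrightarrow> pgen_rank p u \<le> \<alpha>"
  unfolding pgen_rank_def by (rule Least_le)

text \<open>A limit level is the union of earlier ones, so an ultrafilter first appears at a
  successor level, the successor of its rank; monotonicity does the rest.\<close>

lemma pgen_level_iff_pgen_rank_less:
  assumes p: "p \<noteq> bot" and u: "u \<in> pgen p"
  shows "u \<in> pgen_level p \<alpha> \<longleftrightarrow> pgen_rank p u < \<alpha>"
proof
  assume "pgen_rank p u < \<alpha>"
  then show "u \<in> pgen_level p \<alpha>"
    using pgen_level_osuc_pgen_rank[OF p u] pgen_level_mono[OF p, of _ \<alpha>]
    by (auto simp: osuc_le_iff[symmetric])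
next
  assume *: "u \<in> pgen_level p \<alpha>"
  show "pgen_rank p u < \<alpha>"
  proof (cases "limit_ordinal \<alpha>")
    case True
    then obtain \<beta> where \<beta>: "\<beta> < \<alpha>" "u \<in> pgen_level p \<beta>"
      using * by (auto simp: pgen_level_limit)
    then have "u \<in> pgen_level p (osuc \<beta>)"
      using pgen_level_mono[OF p, of \<beta> "osuc \<beta>"] less_imp_le[OF less_osuc] by blast
    then show ?thesis using \<beta>(1) pgen_rank_le order.strict_trans1 by blast
  next
    case False
    moreover have "\<alpha> \<noteq> 0" using * by (auto simp: pgen_level_0)
    ultimately obtain \<beta> where "\<alpha> = osuc \<beta>"
      by (auto simp: limit_ordinal_def)
    then show ?thesis using * pgen_rank_le by (simp add: less_osuc_iff)
  qed
qed

lemma pgen_level_subset_pgen: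
  assumes "p \<noteq> bot"
  shows "pgen_level p \<alpha> \<subseteq> pgen p"
proof (cases "\<alpha> = 0")
  case False
  then have "osuc 0 \<le> \<alpha>"
    by (simp add: osuc_le_iff order.not_eq_order_implies_strict)
  then show ?thesis by (auto simp: pgen_def)
qed (simp add: pgen_level_0)

text \<open>A nonprincipal \<open>u\<close> has nonzero rank, so the successor clause writes it as a
  limit of members of the level indexed by its rank, and these have smaller rank.\<close>

lemma ex_p_generating:
  assumes p: "p \<noteq> bot" and u: "u \<in> pgen p" "u \<notin> principal_ultrafilters"
  obtains us where "p_generating p us u"
proof -
  let ?\<rho> = "pgen_rank p u"
  have mem: "u \<in> pgen_level p (osuc ?\<rho>)"
    by (rule pgen_level_osuc_pgen_rank[OF p u(1)])
  then have "?\<rho> \<noteq> 0" using u(2) by (metis pgen_level_1)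
  then have "osuc 0 \<le> ?\<rho>"
    by (simp add: osuc_le_iff order.not_eq_order_implies_strict)
  then obtain us where us: "u = p_lim p us" "\<And>n. us n \<in> pgen_level p ?\<rho>"
    using mem by (auto simp: pgen_level_osuc)
  have "us n \<in> pgen p" for n
    using us(2) pgen_level_subset_pgen[OF p] by blast
  then have "p_generating p us u"
    using us pgen_level_iff_pgen_rank_less[OF p] by (simp add: p_generating_def)
  then show ?thesis by (rule that)
qed

text \<open>A value taken almost everywhere would be the limit \<open>u\<close>, which would then
  have rank below its own.\<close>

lemma p_generating_not_p_constant:
  assumes "ultrafilter p" "p_generating p us u"
  shows "\<not> p_constant p us"
proof
  have p: "p \<noteq> bot" using assms(1) by (simp add: ultrafilter_def)
  assume "p_constant p us"
  then obtain v where v: "\<forall>\<^sub>F n in p. us n = v" by (auto simp: p_constant_def)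
  then have "u = v"
    using p_lim_eventually_const[OF p v] assms(2) by (simp add: p_generating_def)
  moreover obtain n where "us n = v"
    using eventually_happens'[OF p v] by blast
  ultimately show False
    using assms(2) by (metis order.irrefl p_generating_def)
qed

text \<open>\<open>Sup\<close> is an upper bound only for bounded sets; a countable index type
  guarantees boundedness.\<close>

lemma countable_Sup_upper_ordinal:
  fixes f :: "'a::countable \<Rightarrow> ordinal"
  assumes "x \<in> X"
  shows "f x \<le> (SUP x\<in>X. f x)"
  using assms by (intro cSUP_upper bdd_above_countable_ordinal) auto

text \<open>All \<open>us n\<close> with \<open>n\<close> in \<open>X\<close> lie in the level
  indexed by the supremum, so their limit lies in the next level.\<close>

lemma pgen_rank_p_lim_le:
  assumes p: "p \<noteq> bot" and X: "\<forall>\<^sub>F n in p. n \<in> X" "\<And>n. n \<in> X \<Longrightarrow> us n \<in> pgen p"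
  shows "pgen_rank p (p_lim p us) \<le> (SUP n\<in>X. osuc (pgen_rank p (us n)))" (is "_ \<le> ?\<sigma>")
proof -
  obtain n0 where n0: "n0 \<in> X" using eventually_happens'[OF p X(1)] by blast
  \<comment> \<open>Nothing is known of \<open>us\<close> outside \<open>X\<close>. Filling in the
    value at \<open>n0\<close> puts every term in one level and preserves the limit.\<close>
  define vs where "vs n = us (if n \<in> X then n else n0)" for n
  have upper: "osuc (pgen_rank p (us n)) \<le> ?\<sigma>" if "n \<in> X" for n
    using that by (rule countable_Sup_upper_ordinal)
  have "vs n \<in> pgen_level p ?\<sigma>" for n
    using n0 upper X(2) by (auto simp: vs_def pgen_level_iff_pgen_rank_less[OF p] osuc_le_iff)
  \<comment> \<open>The successor clause of the hierarchy is available from level 1 on, so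
    \<open>?\<sigma>\<close> has to be positive.\<close>
  moreover have "osuc 0 \<le> ?\<sigma>"
  proof -
    have "0 < ?\<sigma>"
      using upper[OF n0] by (auto simp: osuc_le_iff intro: order.strict_trans1[OF zero_le_ordinal])
    then show ?thesis by (simp add: osuc_le_iff)
  qed
  ultimately have "p_lim p vs \<in> pgen_level p (osuc ?\<sigma>)"
    by (auto simp: pgen_level_osuc)
  moreover have "p_equal p us vs"
    using X(1) unfolding p_equal_def by eventually_elim (simp add: vs_def)
  ultimately show ?thesis
    using p_lim_p_equal[OF p] by (metis pgen_rank_le)
qed

theorem theorem3p13:
  fixes p u :: "nat filter" and us :: "nat \<Rightarrow> nat filter"
  assumes "selective p"
    and "u \<in> pgen p" and "u \<notin> principal_ultrafilters"
    and "\<And>n. ultrafilter (us n)"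
    and "u = p_lim p us"
  shows "(\<exists>vs. p_generating p vs u)
       \<and> (\<forall>vs ws. p_generating p vs u \<and> p_generating p ws u \<longrightarrow> p_equal p vs ws)
       \<and> (p_constant p us \<or> (\<forall>vs. p_generating p vs u \<longrightarrow> p_equal p us vs))
       \<and> (\<exists>X. (\<forall>\<^sub>F n in p. n \<in> X)
            \<and> (\<forall>n\<in>X. us n \<in> pgen p)
            \<and> (SUP n\<in>X. pgen_rank p (us n)) \<le> pgen_rank p u
            \<and> (\<not> p_constant p us \<longrightarrow> pgen_rank p u = (SUP n\<in>X. osuc (pgen_rank p (us n)))))"
proof -
  have up: "ultrafilter p" using assms(1) by (simp add: selective_def)
  then have p: "p \<noteq> bot" by (simp add: ultrafilter_def)
  obtain gs where gs: "p_generating p gs u"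
    by (rule ex_p_generating[OF p assms(2,3)])
  \<comment> \<open>Generating sequences are never \<open>p\<close>-constant, so only
    \<open>vs\<close> has to be assumed not \<open>p\<close>-constant.\<close>
  have unique: "p_equal p vs ws"
    if "\<And>n. ultrafilter (vs n)" "u = p_lim p vs" "\<not> p_constant p vs" "p_generating p ws u" for vs ws
    using that assms(1) p_generating_not_p_constant[OF up that(4)] ultrafilter_pgen[OF up]
    by (intro p_lim_eq_imp_p_equal) (auto simp: p_generating_def)
  have gen: "p_equal p vs ws" if "p_generating p vs u" "p_generating p ws u" for vs ws
    using that p_generating_not_p_constant[OF up that(1)] ultrafilter_pgen[OF up]
    by (intro unique) (auto simp: p_generating_def)
  have "\<exists>X. (\<forall>\<^sub>F n in p. n \<in> X) \<and> (\<forall>n\<in>X. us n \<in> pgen p)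
    \<and> (SUP n\<in>X. pgen_rank p (us n)) \<le> pgen_rank p u
    \<and> (\<not> p_constant p us \<longrightarrow> pgen_rank p u = (SUP n\<in>X. osuc (pgen_rank p (us n))))"
  proof (cases "p_constant p us")
    case True
    then obtain v where v: "\<forall>\<^sub>F n in p. us n = v" by (auto simp: p_constant_def)
    then have uv: "u = v" using p_lim_eventually_const[OF p v] assms(5) by simp
    \<comment> \<open>The constant value is the limit \<open>u\<close> itself, so all ranks on
      \<open>?X\<close> equal that of \<open>u\<close>.\<close>
    let ?X = "{n. us n = u}"
    have "?X \<noteq> {}" using eventually_happens'[OF p v] uv by blast
    then have "(SUP n\<in>?X. pgen_rank p (us n)) \<le> pgen_rank p u"
      by (intro cSUP_least) auto
    then show ?thesis
      using v uv True assms(2) by (intro exI[of _ ?X]) auto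
  next
    case False
    \<comment> \<open>On \<open>?X\<close> the sequence inherits from \<open>gs\<close> membership
      in the hierarchy and strictly smaller ranks; strictness bounds even the successors of these
      ranks.\<close>
    let ?X = "{n. us n = gs n}"
    have X: "\<forall>\<^sub>F n in p. n \<in> ?X"
      using unique[OF assms(4,5) False gs] by (simp add: p_equal_def)
    have ne: "?X \<noteq> {}" using eventually_happens'[OF p X] by blast
    have mem: "us n \<in> pgen p" and less: "pgen_rank p (us n) < pgen_rank p u" if "n \<in> ?X" for n
      using gs that by (auto simp: p_generating_def)
    have "(SUP n\<in>?X. pgen_rank p (us n)) \<le> pgen_rank p u"
      using ne less by (intro cSUP_least) (auto intro: less_imp_le)
    moreover have "(SUP n\<in>?X. osuc (pgen_rank p (us n))) \<le> pgen_rank p u"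
      using ne less by (intro cSUP_least) (auto simp: osuc_le_iff)
    moreover have "pgen_rank p u \<le> (SUP n\<in>?X. osuc (pgen_rank p (us n)))"
      unfolding assms(5) by (rule pgen_rank_p_lim_le[OF p]) (use X mem assms(5) in auto)
    ultimately show ?thesis
      using X mem by (intro exI[of _ ?X]) auto
  qed
  then show ?thesis
    using gs gen unique[OF assms(4,5)] by blast
qed

end
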